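(* Let $X$ be a tropical semifield and let $P$ be a convex pentagon with vertices $v_0,v_1,v_2,v_3,v_4$ in cyclic order. Give the sides arbitrary labels in $X$: $v_0v_1$ has label $b$, $v_1v_2$ has label $a$, $v_2v_3$ has label $c$, $v_3v_4$ has label $d$, and $v_4v_0$ has label $e$. Let $T_0$ be the triangulation of $P$ with diagonals $v_0v_2$ and $v_0v_3$, carrying arbitrary labels $x\in X$ and $y\in X$ respectively. Perform successively the five flips $v_0v_3\mapsto v_2v_4$, $v_0v_2\mapsto v_1v_4$, $v_2v_4\mapsto v_1v_3$, $v_1v_4\mapsto v_0v_3$, $v_1v_3\mapsto v_0v_2$, which run through the five triangulations $T_0,T_1,T_2,T_3,T_4$ of $P$ and return to $T_0$. At each flip, assign to the new diagonal the label determined by the tropical Ptolemy relation, leaving all other labels unchanged. Explicitly, the labels of the successive new diagonals are $$z=\max(x+d,\;c+e)-y,\quad t=\max(b+z,\;a+e)-x,\quad u=\max(a+d,\;t+c)-z,$$ $$v=\max(b+d,\;e+u)-t,\quad w=\max(a+v,\;c+b)-u.$$ Then after the five flips all edge labels of $T_0$ return to their initial values. That is, $v=y$ and $w=x$. Equivalently, if $F_i$ denotes the induced map from labelings of $T_i$ to labelings of $T_{i+1}$ (indices modulo $5$), then $F_4\circ F_3\circ F_2\circ F_1\circ F_0=\mathrm{id}$.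
   Context: A tropical semifield is a linearly ordered abelian group $(X,+,\le)$ (for example $\mathbb{R}$) with operations $x\oplus y=\max(x,y)$ and $x\otimes y=x+y$. A flip in a triangulation replaces a diagonal of a convex quadrilateral, formed by two adjacent triangles, by the other diagonal of that quadrilateral. A labeling of a triangulation assigns an element of $X$ to each edge, including boundary edges. Under a flip in a quadrilateral whose sides are labeled $p,q,r,s$ in cyclic order and whose diagonal is labeled $x$, the new diagonal receives the label $y$ determined by the tropical Ptolemy relation $x\otimes y=(p\otimes r)\oplus(q\otimes s)$, i.e. $y=\max(p+r,\,q+s)-x$. All other labels are unchanged. *)

theory Defs
  imports Main "HOL-Library.FuncSet"
begin

text \<open>
  A convex n-gon is modelled combinatorially: its vertices, in cyclic order, are the numbers
  below n, and an edge (side or diagonal) is the two-element set of its endpoints.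
\<close>

type_synonym edge = "nat set"

definition edges :: "nat \<Rightarrow> edge set" where
  "edges n = {{i, j} |i j. i < n \<and> j < n \<and> i \<noteq> j}"

definition sides :: "nat \<Rightarrow> edge set" where
  "sides n = {{i, (i + 1) mod n} |i. i < n}"

definition cyclic_order :: "nat \<Rightarrow> nat \<Rightarrow> nat \<Rightarrow> nat \<Rightarrow> bool" where
  "cyclic_order p q r s \<longleftrightarrow>
     p < q \<and> q < r \<and> r < s \<or> q < r \<and> r < s \<and> s < p \<or>
     r < s \<and> s < p \<and> p < q \<or> s < p \<and> p < q \<and> q < r"

text \<open>Two edges meet in their interiors iff they are the diagonals of a convex quadrilateral.\<close>

definition crosses :: "edge \<Rightarrow> edge \<Rightarrow> bool" where
  "crosses g h \<longleftrightarrow> (\<exists>p q r s. cyclic_order p q r s \<and> g = {p, r} \<and> h = {q, s})"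

text \<open>
  A triangulation is a maximal set of pairwise non-crossing edges; by maximality it contains
  all sides, so that labelings below also label the boundary edges.
\<close>

definition triangulation :: "nat \<Rightarrow> edge set \<Rightarrow> bool" where
  "triangulation n T \<longleftrightarrow>
     T \<subseteq> edges n \<and>
     (\<forall>g\<in>T. \<forall>h\<in>T. \<not> crosses g h) \<and>
     (\<forall>g\<in>edges n. (\<forall>h\<in>T. \<not> crosses g h) \<longrightarrow> g \<in> T)"

text \<open>
  The flip in the quadrilateral with vertices p, q, r, s replaces the diagonal pr, shared by the
  triangles pqr and prs, by the diagonal qs.
\<close>

definition flip_triang :: "nat \<Rightarrow> nat \<Rightarrow> nat \<Rightarrow> nat \<Rightarrow> edge set \<Rightarrow> edge set" where
  "flip_triang p q r s T = insert {q, s} (T - {{p, r}})"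

definition is_flip ::
  "nat \<Rightarrow> nat \<Rightarrow> nat \<Rightarrow> nat \<Rightarrow> nat \<Rightarrow> edge set \<Rightarrow> edge set \<Rightarrow> bool" where
  "is_flip n p q r s T T' \<longleftrightarrow>
     triangulation n T \<and> triangulation n T' \<and> cyclic_order p q r s \<and>
     {{p, q}, {q, r}, {r, s}, {s, p}, {p, r}} \<subseteq> T \<and>
     T' = flip_triang p q r s T"

text \<open>
  Labels live in a linearly ordered abelian group, with maximum as tropical sum and group
  addition as tropical product. Labelings are extensional, so that two of them are equal as soon
  as they agree on the edges of the triangulation.
\<close>

definition labelings :: "edge set \<Rightarrow> (edge \<Rightarrow> 'a::linordered_ab_group_add) set" where
  "labelings T = T \<rightarrow>\<^sub>E UNIV"

definition flip_label ::
  "nat \<Rightarrow> nat \<Rightarrow> nat \<Rightarrow> nat \<Rightarrow> edge set \<Rightarrow> (edge \<Rightarrow> 'a::linordered_ab_group_add) \<Rightarrow> edge \<Rightarrow> 'a" where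
  "flip_label p q r s T L =
     (\<lambda>g\<in>flip_triang p q r s T.
        if g = {q, s} then max (L {p, q} + L {r, s}) (L {q, r} + L {s, p}) - L {p, r}
        else L g)"

definition pent_triang :: "nat \<Rightarrow> edge set" where
  "pent_triang i = sides 5 \<union>
     [{{0, 2}, {0, 3}}, {{0, 2}, {2, 4}}, {{1, 4}, {2, 4}}, {{1, 4}, {1, 3}}, {{0, 3}, {1, 3}}] ! i"

definition F0 :: "(edge \<Rightarrow> 'a::linordered_ab_group_add) \<Rightarrow> edge \<Rightarrow> 'a" where
  "F0 = flip_label 0 2 3 4 (pent_triang 0)"

definition F1 :: "(edge \<Rightarrow> 'a::linordered_ab_group_add) \<Rightarrow> edge \<Rightarrow> 'a" where
  "F1 = flip_label 0 1 2 4 (pent_triang 1)"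

definition F2 :: "(edge \<Rightarrow> 'a::linordered_ab_group_add) \<Rightarrow> edge \<Rightarrow> 'a" where
  "F2 = flip_label 2 3 4 1 (pent_triang 2)"

definition F3 :: "(edge \<Rightarrow> 'a::linordered_ab_group_add) \<Rightarrow> edge \<Rightarrow> 'a" where
  "F3 = flip_label 1 3 4 0 (pent_triang 3)"

definition F4 :: "(edge \<Rightarrow> 'a::linordered_ab_group_add) \<Rightarrow> edge \<Rightarrow> 'a" where
  "F4 = flip_label 1 2 3 0 (pent_triang 4)"

end

theory Submission
  imports Defs
begin

text \<open>A linearly ordered group has no tropical subtraction, but it is cancellative: after adding
  \<open>x + z\<close> (for \<open>v = y\<close>) or \<open>z\<close> (for \<open>w = x\<close>) to both sides, the Ptolemy relations expand both to
  the same maximum of sums of labels.\<close>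

section \<open>The tropical identity behind the pentagon relation\<close>

lemma tropical_pentagon:
  fixes a b c d e x y z t u v w :: "'a::linordered_ab_group_add"
  assumes z: "z = max (x + d) (c + e) - y"
    and t: "t = max (b + z) (a + e) - x"
    and u: "u = max (a + d) (t + c) - z"
    and v: "v = max (b + d) (e + u) - t"
    and w: "w = max (a + v) (c + b) - u"
  shows "v = y" "w = x"
proof -
  have yz: "y + z = max (x + d) (c + e)" and xt: "x + t = max (b + z) (a + e)"
    and uz: "u + z = max (a + d) (t + c)"
    using z t u by (simp_all add: algebra_simps)
  \<comment> \<open>The first maximum is \<open>v + t\<close>. The shift by \<open>z\<close>
    completes \<open>u\<close> to \<open>u + z\<close>; expanding that maximum produces
    \<open>t + c\<close>, which the shift by \<open>x\<close> completes to
    \<open>x + t\<close>.\<close>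
  have "max (b + d) (e + u) + (x + z) = max (b + d + x + z) (e + x + (u + z))"
    by (simp add: max_add_distrib_left max_add_distrib_right add_ac)
  also have "\<dots> = max (b + d + x + z) (max (e + x + a + d) (e + c + (x + t)))"
    unfolding uz by (simp add: max_add_distrib_left max_add_distrib_right add_ac)
  \<comment> \<open>Expanding \<open>x + t\<close> leaves four sums, which are exactly the terms of
    the tropical product of the maxima for \<open>y + z\<close> and \<open>x + t\<close>.\<close>
  also have "\<dots> = max (x + d) (c + e) + max (b + z) (a + e)"
    unfolding xt by (simp add: max_add_distrib_left max_add_distrib_right add_ac max.assoc max.left_commute max.commute)
  also have "\<dots> = (y + t) + (x + z)"
    unfolding yz[symmetric] xt[symmetric] by (simp add: add_ac)
  finally show vy: "v = y"
    unfolding v by (simp add: algebra_simps)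
  \<comment> \<open>With \<open>v = y\<close> known, the shift by \<open>z\<close> makes
    \<open>y + z\<close> appear. Its term \<open>a + c + e\<close> regroups with
    \<open>c + b + z\<close> to \<open>c + (x + t)\<close>, after which \<open>x\<close> factors
    out.\<close>
  have "max (a + y) (c + b) + z = max (a + (y + z)) (c + b + z)"
    by (simp add: max_add_distrib_left max_add_distrib_right add_ac)
  also have "\<dots> = max (x + a + d) (c + (x + t))"
    unfolding yz xt by (simp add: max_add_distrib_left max_add_distrib_right add_ac max.assoc max.left_commute max.commute)
  also have "\<dots> = x + (u + z)"
    unfolding uz by (simp add: max_add_distrib_left max_add_distrib_right add_ac)
  finally show "w = x"
    unfolding w vy by (simp add: algebra_simps)
qed

section \<open>Crossing edges and the triangulations of the pentagon\<close>

text \<open>Each unordered pair can be named in two ways, which gives four cyclic orders. Without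
  the existential quantifiers, crossing of concrete edges reduces to comparisons of
  numerals.\<close>

lemma crosses_doubleton_iff:
  "crosses {i, j} {k, l} \<longleftrightarrow>
     cyclic_order i k j l \<or> cyclic_order i l j k \<or> cyclic_order j k i l \<or> cyclic_order j l i k"
  unfolding crosses_def doubleton_eq_iff by metis

text \<open>Because crossing is symmetric, non-crossing and maximality merge into one equivalence:
  an edge belongs to \<open>T\<close> exactly if no edge of \<open>T\<close> crosses it. All
  quantifiers range over \<open>edges n\<close>, which can be enumerated for
  \<open>n = 5\<close>.\<close>

lemma triangulation_iff:
  "triangulation n T \<longleftrightarrow>
     T \<subseteq> edges n \<and> (\<forall>g\<in>edges n. g \<in> T \<longleftrightarrow> (\<forall>h\<in>edges n. crosses g h \<longrightarrow> h \<notin> T))"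
proof -
  \<comment> \<open>Rotating the four vertices by one place exchanges the two diagonals of the
    quadrilateral.\<close>
  have "cyclic_order p q r s \<Longrightarrow> cyclic_order q r s p" for p q r s
    by (auto simp: cyclic_order_def)
  then have "crosses h g" if "crosses g h" for g h
    using that unfolding crosses_def by (metis insert_commute)
  then show ?thesis
    unfolding triangulation_def by blast
qed

lemma edges_5:
  "edges 5 = {{0,1},{1,2},{2,3},{3,4},{4,0},{0,2},{1,3},{2,4},{0,3},{1,4}}"
proof -
  have "edges 5 = (\<Union>i\<in>{..<5}. \<Union>j\<in>{..<5} - {i}. {{i, j}})"
    by (fastforce simp: edges_def)
  also have "{..<5::nat} = {0,1,2,3,4}"
    by auto
  finally show ?thesis
    by (simp add: insert_Diff_if insert_commute del: One_nat_def)
qed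

lemma sides_5: "sides 5 = {{0,1},{1,2},{2,3},{3,4},{4,0}}"
proof -
  have "sides 5 = (\<lambda>i. {i, (i + 1) mod 5}) ` {..<5}"
    by (auto simp: sides_def)
  also have "{..<5::nat} = {0,1,2,3,4}"
    by auto
  finally show ?thesis
    by (simp add: insert_commute numeral_2_eq_2)
qed

lemmas pent_triang_simps =
  pent_triang_def[of 0] pent_triang_def[of 1] pent_triang_def[of 2] pent_triang_def[of 3]
  pent_triang_def[of 4]

text \<open>The crossing relation on the five diagonals is a 5-cycle, whose maximal independent sets
  are the five pairs of non-adjacent diagonals.\<close>

lemma triangulation_5_iff:
  "triangulation 5 T \<longleftrightarrow>
     T \<subseteq> edges 5 \<and> sides 5 \<subseteq> T \<and>
     ({0,2} \<in> T \<longleftrightarrow> {1,3} \<notin> T \<and> {1,4} \<notin> T) \<and>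
     ({1,3} \<in> T \<longleftrightarrow> {0,2} \<notin> T \<and> {2,4} \<notin> T) \<and>
     ({2,4} \<in> T \<longleftrightarrow> {1,3} \<notin> T \<and> {0,3} \<notin> T) \<and>
     ({0,3} \<in> T \<longleftrightarrow> {2,4} \<notin> T \<and> {1,4} \<notin> T) \<and>
     ({1,4} \<in> T \<longleftrightarrow> {0,2} \<notin> T \<and> {0,3} \<notin> T)"
  unfolding triangulation_iff
  unfolding edges_5 sides_5 ball_simps crosses_doubleton_iff cyclic_order_def
  by simp

lemma pent_triang_in_triangulations: "i < 5 \<Longrightarrow> triangulation 5 (pent_triang i)"
proof -
  assume "i < 5"
  then have "i \<in> {0,1,2,3,4}"
    by auto
  then show ?thesis
    by (elim insertE emptyE; simp add: triangulation_5_iff pent_triang_def sides_5 edges_5 doubleton_eq_iff)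
qed

lemma triangulation_5_cases:
  assumes "triangulation 5 T"
  shows "\<exists>i<5. T = pent_triang i"
proof -
  define D :: "edge set" where "D = {{0,2},{1,3},{2,4},{0,3},{1,4}}"
  have "edges 5 = sides 5 \<union> D"
    by (simp add: edges_5 sides_5 D_def insert_commute)
  \<comment> \<open>Since all sides lie in \<open>T\<close>, only the choice of diagonals remains to
    be determined.\<close>
  then have T: "T = sides 5 \<union> (T \<inter> D)"
    using assms unfolding triangulation_5_iff by blast
  let ?P = "\<lambda>i j. {i,j} \<in> T"
  \<comment> \<open>These are all solutions of the five Boolean equations for the diagonals, in the
    order of the indices of \<open>pent_triang\<close>.\<close>
  consider "?P 0 2" "?P 0 3" "\<not> ?P 2 4" "\<not> ?P 1 4" "\<not> ?P 1 3"
    | "?P 0 2" "?P 2 4" "\<not> ?P 0 3" "\<not> ?P 1 4" "\<not> ?P 1 3"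
    | "?P 1 4" "?P 2 4" "\<not> ?P 0 2" "\<not> ?P 0 3" "\<not> ?P 1 3"
    | "?P 1 4" "?P 1 3" "\<not> ?P 0 2" "\<not> ?P 0 3" "\<not> ?P 2 4"
    | "?P 0 3" "?P 1 3" "\<not> ?P 0 2" "\<not> ?P 1 4" "\<not> ?P 2 4"
    using assms unfolding triangulation_5_iff by argo
  then have "T = pent_triang 0 \<or> T = pent_triang 1 \<or> T = pent_triang 2 \<or> T = pent_triang 3 \<or> T = pent_triang 4"
  proof cases
    case 1
    then have "T \<inter> D = {{0,2},{0,3}}" by (simp add: D_def Int_insert_right)
    with T have "T = pent_triang 0" by (simp add: pent_triang_def)
    then show ?thesis by blast
  next
    case 2
    then have "T \<inter> D = {{0,2},{2,4}}" by (simp add: D_def Int_insert_right)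
    with T have "T = pent_triang 1" by (simp add: pent_triang_def)
    then show ?thesis by blast
  next
    case 3
    then have "T \<inter> D = {{1,4},{2,4}}" by (simp add: D_def Int_insert_right insert_commute)
    with T have "T = pent_triang 2" by (simp add: pent_triang_def)
    then show ?thesis by blast
  next
    case 4
    then have "T \<inter> D = {{1,4},{1,3}}" by (simp add: D_def Int_insert_right insert_commute)
    with T have "T = pent_triang 3" by (simp add: pent_triang_def)
    then show ?thesis by blast
  next
    case 5
    then have "T \<inter> D = {{0,3},{1,3}}" by (simp add: D_def Int_insert_right insert_commute)
    with T have "T = pent_triang 4" by (simp add: pent_triang_def)
    then show ?thesis by blast
  qed
  moreover have "(0::nat) < 5" "(1::nat) < 5" "(2::nat) < 5" "(3::nat) < 5" "(4::nat) < 5"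
    by simp_all
  ultimately show ?thesis
    by blast
qed

lemma bij_betw_pent_triang: "bij_betw pent_triang {..<5} {T. triangulation 5 T}"
  unfolding bij_betw_def
proof
  \<comment> \<open>Three diagonals suffice to tell the five indices apart: their membership
    patterns are pairwise different.\<close>
  have diag: "{0,2} \<in> pent_triang i \<longleftrightarrow> i = 0 \<or> i = 1" "{2,4} \<in> pent_triang i \<longleftrightarrow> i = 1 \<or> i = 2"
    "{1,4} \<in> pent_triang i \<longleftrightarrow> i = 2 \<or> i = 3" if "i < 5" for i
  proof -
    have "i \<in> {0,1,2,3,4}"
      using that by auto
    then show "{0,2} \<in> pent_triang i \<longleftrightarrow> i = 0 \<or> i = 1" "{2,4} \<in> pent_triang i \<longleftrightarrow> i = 1 \<or> i = 2"
      "{1,4} \<in> pent_triang i \<longleftrightarrow> i = 2 \<or> i = 3"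
      by (auto simp: pent_triang_def sides_5 doubleton_eq_iff)
  qed
  show "inj_on pent_triang {..<5}"
  proof (rule inj_onI)
    fix i j assume "i \<in> {..<5}" "j \<in> {..<5}" "pent_triang i = pent_triang j"
    then have "i < 5" "j < 5" "i = 0 \<or> i = 1 \<longleftrightarrow> j = 0 \<or> j = 1" "i = 1 \<or> i = 2 \<longleftrightarrow> j = 1 \<or> j = 2"
      "i = 2 \<or> i = 3 \<longleftrightarrow> j = 2 \<or> j = 3"
      using diag[of i] diag[of j] by auto
    then show "i = j"
      by presburger
  qed
  show "pent_triang ` {..<5} = {T. triangulation 5 T}"
    using pent_triang_in_triangulations triangulation_5_cases by auto
qed

section \<open>The five flips and their action on labelings\<close>

lemma flip_pent_triang:
  "flip_triang 0 2 3 4 (pent_triang 0) = pent_triang 1"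
  "flip_triang 0 1 2 4 (pent_triang 1) = pent_triang 2"
  "flip_triang 2 3 4 1 (pent_triang 2) = pent_triang 3"
  "flip_triang 1 3 4 0 (pent_triang 3) = pent_triang 4"
  "flip_triang 1 2 3 0 (pent_triang 4) = pent_triang 0"
  unfolding flip_triang_def pent_triang_simps sides_5
  by (simp_all add: doubleton_eq_iff insert_Diff_if) (simp_all add: insert_commute)

lemma is_flip_pent_triang:
  "is_flip 5 0 2 3 4 (pent_triang 0) (pent_triang 1)"
  "is_flip 5 0 1 2 4 (pent_triang 1) (pent_triang 2)"
  "is_flip 5 2 3 4 1 (pent_triang 2) (pent_triang 3)"
  "is_flip 5 1 3 4 0 (pent_triang 3) (pent_triang 4)"
  "is_flip 5 1 2 3 0 (pent_triang 4) (pent_triang 0)"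
  unfolding is_flip_def flip_pent_triang
  by (simp_all add: pent_triang_in_triangulations cyclic_order_def)
     (simp_all add: pent_triang_def sides_5 doubleton_eq_iff)

text \<open>\<open>flip_label\<close> restricts its result to the flipped triangulation, which makes
  it extensional there.\<close>

lemma flip_label_in_labelings: "is_flip n p q r s T T' \<Longrightarrow> flip_label p q r s T L \<in> labelings T'"
  by (simp add: is_flip_def flip_label_def labelings_def)

lemma flip_label_new:
  "flip_label p q r s T L {q, s} = max (L {p, q} + L {r, s}) (L {q, r} + L {s, p}) - L {p, r}"
  by (simp add: flip_label_def flip_triang_def)

lemma flip_label_old:
  "g \<in> T \<Longrightarrow> g \<noteq> {p, r} \<Longrightarrow> g \<noteq> {q, s} \<Longrightarrow> flip_label p q r s T L g = L g"
  by (simp add: flip_label_def flip_triang_def)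

lemma flip_maps_labelings:
  "F0 L \<in> labelings (pent_triang 1)" "F1 L \<in> labelings (pent_triang 2)"
  "F2 L \<in> labelings (pent_triang 3)" "F3 L \<in> labelings (pent_triang 4)"
  "F4 L \<in> labelings (pent_triang 0)"
  unfolding F0_def F1_def F2_def F3_def F4_def
  by (fact is_flip_pent_triang[THEN flip_label_in_labelings])+

lemma labelings_eqI:
  "L \<in> labelings T \<Longrightarrow> M \<in> labelings T \<Longrightarrow> (\<And>g. g \<in> T \<Longrightarrow> L g = M g) \<Longrightarrow> L = M"
  unfolding labelings_def by (rule PiE_ext)

text \<open>The Ptolemy relations with edges and summands in the order of the theorem. The last
  three flips name some edges with reversed endpoints, hence \<open>swap\<close> and
  commutativity.\<close>

lemma flip_new_diagonal:
  "F0 L {2,4} = max (L {0,2} + L {3,4}) (L {2,3} + L {4,0}) - L {0,3}"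
  "F1 L {1,4} = max (L {0,1} + L {2,4}) (L {1,2} + L {4,0}) - L {0,2}"
  "F2 L {1,3} = max (L {1,2} + L {3,4}) (L {1,4} + L {2,3}) - L {2,4}"
  "F3 L {0,3} = max (L {0,1} + L {3,4}) (L {4,0} + L {1,3}) - L {1,4}"
  "F4 L {0,2} = max (L {1,2} + L {0,3}) (L {2,3} + L {0,1}) - L {1,3}"
proof -
  have swap: "{3,1} = {1,3::nat}" "{3,0} = {0,3::nat}" "{2,0} = {0,2::nat}" "{4,1} = {1,4::nat}"
    "{1,0} = {0,1::nat}"
    by (rule insert_commute)+
  note new = flip_label_new[of 2 3 4 1 _ L] flip_label_new[of 1 3 4 0 _ L] flip_label_new[of 1 2 3 0 _ L]
  show "F0 L {2,4} = max (L {0,2} + L {3,4}) (L {2,3} + L {4,0}) - L {0,3}"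
    "F1 L {1,4} = max (L {0,1} + L {2,4}) (L {1,2} + L {4,0}) - L {0,2}"
    unfolding F0_def F1_def by (rule flip_label_new)+
  show "F2 L {1,3} = max (L {1,2} + L {3,4}) (L {1,4} + L {2,3}) - L {2,4}"
    "F3 L {0,3} = max (L {0,1} + L {3,4}) (L {4,0} + L {1,3}) - L {1,4}"
    "F4 L {0,2} = max (L {1,2} + L {0,3}) (L {2,3} + L {0,1}) - L {1,3}"
    unfolding F2_def F3_def F4_def new[unfolded swap]
    by (simp_all only: add.commute max.commute)
qed

text \<open>The diagonal inserted in each line is the one shared by the triangulations before and
  after that flip.\<close>

lemma flip_other_edges:
  "g \<in> insert {0,2} (sides 5) \<Longrightarrow> F0 L g = L g"
  "g \<in> insert {2,4} (sides 5) \<Longrightarrow> F1 L g = L g"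
  "g \<in> insert {1,4} (sides 5) \<Longrightarrow> F2 L g = L g"
  "g \<in> insert {1,3} (sides 5) \<Longrightarrow> F3 L g = L g"
  "g \<in> insert {0,3} (sides 5) \<Longrightarrow> F4 L g = L g"
  unfolding F0_def F1_def F2_def F3_def F4_def
  by (auto intro!: flip_label_old simp: pent_triang_simps sides_5 doubleton_eq_iff simp del: One_nat_def)

section \<open>Return of the labels after five flips\<close>

lemma pentagon_flip_labels:
  fixes L :: "edge \<Rightarrow> 'a::linordered_ab_group_add"
  assumes z: "z = max (L {0,2} + L {3,4}) (L {2,3} + L {4,0}) - L {0,3}"
    and t: "t = max (L {0,1} + z) (L {1,2} + L {4,0}) - L {0,2}"
    and u: "u = max (L {1,2} + L {3,4}) (t + L {2,3}) - z"
    and v: "v = max (L {0,1} + L {3,4}) (L {4,0} + u) - t"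
    and w: "w = max (L {1,2} + v) (L {2,3} + L {0,1}) - u"
  shows "F0 L {2,4} = z" "F1 (F0 L) {1,4} = t" "F2 (F1 (F0 L)) {1,3} = u"
    "F3 (F2 (F1 (F0 L))) {0,3} = v" "F4 (F3 (F2 (F1 (F0 L)))) {0,2} = w"
    "\<And>g. g \<in> pent_triang 0 \<Longrightarrow> F4 (F3 (F2 (F1 (F0 L)))) g = L g"
proof -
  \<comment> \<open>Each Ptolemy relation reads side labels and diagonal labels that are initial or
    come from earlier flips; \<open>old\<close> carries these through the flips in between.\<close>
  note old = flip_other_edges sides_5
  show z': "F0 L {2,4} = z"
    by (simp add: flip_new_diagonal(1) z)
  show t': "F1 (F0 L) {1,4} = t"
    by (simp add: flip_new_diagonal(2) old z' t del: One_nat_def)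
  show u': "F2 (F1 (F0 L)) {1,3} = u"
    by (simp add: flip_new_diagonal(3) old z' t' u del: One_nat_def)
  show v': "F3 (F2 (F1 (F0 L))) {0,3} = v"
    by (simp add: flip_new_diagonal(4) old t' u' v del: One_nat_def)
  show w': "F4 (F3 (F2 (F1 (F0 L)))) {0,2} = w"
    by (simp add: flip_new_diagonal(5) old u' v' w del: One_nat_def)
  have "v = L {0,3}" "w = L {0,2}"
    using tropical_pentagon[OF z t u v w] by simp_all
  \<comment> \<open>Sides are never relabeled, \<open>{0,2}\<close> ends with \<open>w\<close>, and
    \<open>{0,3}\<close> keeps the label \<open>v\<close> because the last flip leaves it in
    place.\<close>
  moreover have "g \<in> sides 5 \<or> g = {0,2} \<or> g = {0,3}" if "g \<in> pent_triang 0" for g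
    using that by (simp add: pent_triang_def) blast
  ultimately show "F4 (F3 (F2 (F1 (F0 L)))) g = L g" if "g \<in> pent_triang 0" for g
    using that v' w' by (fastforce simp: flip_other_edges)
qed

lemma pentagon_flips_id:
  fixes L :: "edge \<Rightarrow> 'a::linordered_ab_group_add"
  assumes "L \<in> labelings (pent_triang 0)"
  shows "F4 (F3 (F2 (F1 (F0 L)))) = L"
  \<comment> \<open>Both sides are extensional on \<open>pent_triang 0\<close>, so agreement on its
    edges gives equality of functions. The \<open>refl\<close> facts set \<open>z\<close>,
    \<open>t\<close>, \<open>u\<close>, \<open>v\<close>, \<open>w\<close> to their defining
    expressions.\<close>
  using flip_maps_labelings(5) assms pentagon_flip_labels(6)[OF refl refl refl refl refl]
  by (rule labelings_eqI)

theorem mainTheorem1: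
  fixes a b c d e x y z t u v w :: "'a::linordered_ab_group_add"
  assumes z: "z = max (x + d) (c + e) - y"
    and t: "t = max (b + z) (a + e) - x"
    and u: "u = max (a + d) (t + c) - z"
    and v: "v = max (b + d) (e + u) - t"
    and w: "w = max (a + v) (c + b) - u"
  shows
    "(bij_betw pent_triang {..<5} {T. triangulation 5 T}
       \<and> is_flip 5 0 2 3 4 (pent_triang 0) (pent_triang 1)
       \<and> is_flip 5 0 1 2 4 (pent_triang 1) (pent_triang 2)
       \<and> is_flip 5 2 3 4 1 (pent_triang 2) (pent_triang 3)
       \<and> is_flip 5 1 3 4 0 (pent_triang 3) (pent_triang 4)
       \<and> is_flip 5 1 2 3 0 (pent_triang 4) (pent_triang 0))
     \<and> v = y \<and> w = x
     \<and> (\<forall>L\<in>labelings (pent_triang 0) :: (edge \<Rightarrow> 'a) set.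
          L {0, 1} = b \<and> L {1, 2} = a \<and> L {2, 3} = c \<and> L {3, 4} = d \<and> L {4, 0} = e \<and>
          L {0, 2} = x \<and> L {0, 3} = y \<longrightarrow>
            F0 L {2, 4} = z
            \<and> (F1 \<circ> F0) L {1, 4} = t
            \<and> (F2 \<circ> F1 \<circ> F0) L {1, 3} = u
            \<and> (F3 \<circ> F2 \<circ> F1 \<circ> F0) L {0, 3} = v
            \<and> (F4 \<circ> F3 \<circ> F2 \<circ> F1 \<circ> F0) L {0, 2} = w
            \<and> (\<forall>g\<in>pent_triang 0. (F4 \<circ> F3 \<circ> F2 \<circ> F1 \<circ> F0) L g = L g))
     \<and> (F0 \<in> labelings (pent_triang 0) \<rightarrow> (labelings (pent_triang 1) :: (edge \<Rightarrow> 'a) set)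
       \<and> F1 \<in> labelings (pent_triang 1) \<rightarrow> (labelings (pent_triang 2) :: (edge \<Rightarrow> 'a) set)
       \<and> F2 \<in> labelings (pent_triang 2) \<rightarrow> (labelings (pent_triang 3) :: (edge \<Rightarrow> 'a) set)
       \<and> F3 \<in> labelings (pent_triang 3) \<rightarrow> (labelings (pent_triang 4) :: (edge \<Rightarrow> 'a) set)
       \<and> F4 \<in> labelings (pent_triang 4) \<rightarrow> (labelings (pent_triang 0) :: (edge \<Rightarrow> 'a) set)
       \<and> (\<forall>M\<in>labelings (pent_triang 0) :: (edge \<Rightarrow> 'a) set.
            (F4 \<circ> F3 \<circ> F2 \<circ> F1 \<circ> F0) M = id M))"
proof (intro conjI ballI impI funcsetI)
  show "v = y" "w = x"
    using tropical_pentagon[OF z t u v w] by simp_all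
next
  fix L :: "edge \<Rightarrow> 'a"
  assume "L {0, 1} = b \<and> L {1, 2} = a \<and> L {2, 3} = c \<and> L {3, 4} = d \<and> L {4, 0} = e \<and>
          L {0, 2} = x \<and> L {0, 3} = y"
  then have L: "L {0, 1} = b" "L {1, 2} = a" "L {2, 3} = c" "L {3, 4} = d" "L {4, 0} = e"
    "L {0, 2} = x" "L {0, 3} = y"
    by blast+
  \<comment> \<open>Replacing the values of \<open>L\<close> by their letters turns the premises
    into the given equations for \<open>z\<close> to \<open>w\<close>.\<close>
  note labels = pentagon_flip_labels[of z L t u v w, unfolded L, OF z t u v w]
  show "F0 L {2, 4} = z" "(F1 \<circ> F0) L {1, 4} = t" "(F2 \<circ> F1 \<circ> F0) L {1, 3} = u"
    "(F3 \<circ> F2 \<circ> F1 \<circ> F0) L {0, 3} = v" "(F4 \<circ> F3 \<circ> F2 \<circ> F1 \<circ> F0) L {0, 2} = w"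
    unfolding o_apply by (fact labels)+
  show "(F4 \<circ> F3 \<circ> F2 \<circ> F1 \<circ> F0) L g = L g" if "g \<in> pent_triang 0" for g
    unfolding o_apply using that by (rule labels)
next
  fix M :: "edge \<Rightarrow> 'a"
  assume "M \<in> labelings (pent_triang 0)"
  then show "(F4 \<circ> F3 \<circ> F2 \<circ> F1 \<circ> F0) M = id M"
    by (simp add: pentagon_flips_id)
qed (rule bij_betw_pent_triang is_flip_pent_triang flip_maps_labelings)+

end
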